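(* Let $\frac ab$ be an irreducible rational number, i.e. $a\in\mathbb{Z}$, $b\in\mathbb{Z}_{>0}$, $\gcd(a,b)=1$, and let $\left[\frac ab\right]_q$ be its $q$-deformation (the associated $q$-rational), a rational function of $q$. Then the second derivative of $\left[\frac ab\right]_q$ with respect to $q$ at $q=1$ is $$\frac{d^2}{dq^2}\left[\frac ab\right]_q\Big|_{q=1}=F\!\left(\frac ab\right)+f\!\left(\frac ab\right)^2G\!\left(\frac ab\right)+20\sum_{n=1}^{b-1}\left\langle\frac na\right\rangle_b H\!\left(\frac nb\right),$$ where - $f$ is Thomae's function, so $f\!\left(\frac ab\right)=\frac1b$; - $F(x)=\frac13x^3-x^2+\frac53x-1$; - $G(x)=1-x$; - $H(x)=x^2(1-x)$; - $\left\langle\frac na\right\rangle_b=\dfrac{na^{-1}\bmod b}{b}-\dfrac12$, where $a^{-1}$ is the inverse of $a$ in the multiplicative group $(\mathbb{Z}/b\mathbb{Z})^\times$ and $y\bmod b$ denotes the integer between $0$ and $b-1$ representing the congruence class of $y$ modulo $b$.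
   Context: Definition of the $q$-rationals. For an integer $n$, the $q$-integer is $[n]_q=\frac{1-q^n}{1-q}$ (so $[n]_q=1+q+\cdots+q^{n-1}$ for $n\ge 1$, $[0]_q=0$, and $[n]_q$ is a Laurent polynomial in $q$ for $n<0$), with value $n$ at $q=1$; $[n]_{1/q}$ denotes the result of replacing $q$ by $1/q$ in $[n]_q$. For a rational number $x$ with finite regular continued fraction expansion $$x=a_0+\cfrac{1}{a_1+\cfrac{1}{a_2+\cfrac{1}{\ddots+\cfrac{1}{a_m}}}},\qquad a_0\in\mathbb{Z},\ a_1,\dots,a_m\in\mathbb{Z}_{\ge1},$$ its $q$-deformation is the rational function $$[x]_q=[a_0]_q+\cfrac{q^{a_0}}{[a_1]_{1/q}+\cfrac{q^{-a_1}}{[a_2]_q+\cfrac{q^{a_2}}{[a_3]_{1/q}+\cfrac{q^{-a_3}}{\ddots}}}}$$ where the terms at even index $i$ are $[a_i]_q$ (followed by numerator $q^{a_i}$), the terms at odd index $i$ are $[a_i]_{1/q}$ (followed by numerator $q^{-a_i}$), and the expression terminates with $[a_m]_q$ if $m$ is even and $[a_m]_{1/q}$ if $m$ is odd. The result does not depend on which of the two finite continued fraction expansions of $x$ is used, and $[x]_q$ takes the value $x$ at $q=1$. Thomae's function is $f(x)=\frac1b$ if $x=\frac ab$ with $a\in\mathbb{Z}$, $b\in\mathbb{Z}_{>0}$, $\gcd(a,b)=1$, and $f(x)=0$ if $x\notin\mathbb{Q}$. The sum over $n$ is empty (equal to $0$) when $b=1$. The symbol $\left\langle\frac na\right\rangle_b$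 is a formal notation depending on the integers $n,a,b$. *)

theory Defs
  imports
    "HOL-Analysis.Analysis"
    "HOL-Computational_Algebra.Computational_Algebra"
    "HOL-Computational_Algebra.Field_as_Ring"
    "HOL-Number_Theory.Modular_Inverse"
begin

subsection \<open>Finite regular continued fractions\<close>

fun cf_value :: "int list \<Rightarrow> rat" where
  "cf_value [] = 0"
| "cf_value [a] = of_int a"
| "cf_value (a # as) = of_int a + 1 / cf_value as"

definition is_cf_expansion :: "int list \<Rightarrow> rat \<Rightarrow> bool" where
  "is_cf_expansion as x \<longleftrightarrow>
     as \<noteq> [] \<and> (\<forall>a\<in>set (tl as). a \<ge> 1) \<and> cf_value as = x"

subsection \<open>The \<open>q\<close>-rationals\<close>

definition q_int :: "'a::field \<Rightarrow> int \<Rightarrow> 'a" where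
  "q_int q n = (1 - q powi n) / (1 - q)"

text \<open>
  Passing to the tail replaces \<open>q\<close> by \<open>1 / q\<close>. Hence the term of index \<open>i\<close> and the numerator
  following it are \<open>q_int q a\<^sub>i\<close> and \<open>q powi a\<^sub>i\<close> for even \<open>i\<close>, and
  \<open>q_int (1 / q) a\<^sub>i\<close> and \<open>(1 / q) powi a\<^sub>i = q powi (- a\<^sub>i)\<close> for odd \<open>i\<close>.
\<close>

fun q_cf :: "'a::field \<Rightarrow> int list \<Rightarrow> 'a" where
  "q_cf q [] = 0"
| "q_cf q [a] = q_int q a"
| "q_cf q (a # as) = q_int q a + q powi a / q_cf (1 / q) as"

text \<open>
  Rational functions of \<open>q\<close> are elements of the field of fractions of \<open>\<real>[q]\<close>; the indeterminate
  is \<open>ratfun_var\<close>. Since it is different from \<open>1\<close>, the quotient in \<open>q_int ratfun_var n\<close> is a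
  genuine one.
\<close>

type_synonym ratfun = "real poly fract"

definition ratfun_var :: ratfun where
  "ratfun_var = Fract [:0, 1:] 1"

text \<open>Evaluation uses the representation in lowest terms, so removable singularities such as
  that of \<open>(1 - q ^ n) / (1 - q)\<close> at \<open>1\<close> disappear.\<close>

definition ratfun_eval :: "ratfun \<Rightarrow> real \<Rightarrow> real" where
  "ratfun_eval R t = (case quot_of_fract R of (N, D) \<Rightarrow> poly N t / poly D t)"

text \<open>The choice of the expansion is immaterial, see \<open>q_rat_eq\<close> below.\<close>

definition q_rat :: "rat \<Rightarrow> ratfun" where
  "q_rat x = q_cf ratfun_var (SOME as. is_cf_expansion as x)"

lemma cf_value_Cons: "as \<noteq> [] \<Longrightarrow> cf_value (a # as) = of_int a + 1 / cf_value as"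
  by (cases as) auto

lemma q_cf_Cons: "as \<noteq> [] \<Longrightarrow> q_cf q (a # as) = q_int q a + q powi a / q_cf (1 / q) as"
  by (cases as) auto

lemma cf_value_ge_1: "as \<noteq> [] \<Longrightarrow> \<forall>a\<in>set as. a \<ge> 1 \<Longrightarrow> cf_value as \<ge> 1"
proof (induction as)
  case (Cons a as)
  show ?case
  proof (cases "as = []")
    case True thus ?thesis using Cons.prems by simp
  next
    case False
    hence "1 / cf_value as \<ge> 0" using Cons by simp
    moreover have "(of_int a :: rat) \<ge> 1" using Cons.prems by simp
    ultimately show ?thesis unfolding cf_value_Cons[OF False] by linarith
  qed
qed simp

lemma cf_expansion_exists: "\<exists>as. is_cf_expansion as x"
proof -
  have *: "\<exists>as. is_cf_expansion as (of_int a / of_int (int b))" if "b > 0" for a b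
    using that
  proof (induction b arbitrary: a rule: less_induct)
    case (less b)
    define c where "c = a div int b"
    define r where "r = a mod int b"
    have a: "a = c * int b + r" by (simp add: c_def r_def)
    have r: "0 \<le> r" "r < int b" using less.prems by (auto simp: r_def)
    show ?case
    proof (cases "r = 0")
      case True
      hence "is_cf_expansion [c] (of_int a / of_int (int b))"
        using a less.prems by (simp add: is_cf_expansion_def)
      thus ?thesis by blast
    next
      case False
      with r have "nat r < b" "nat r > 0" by auto
      from less.IH[OF this, of "int b"] r
      obtain as where as: "is_cf_expansion as (of_int (int b) / of_int r)" by auto
      obtain d ds where ds: "as = d # ds" using as by (cases as) (auto simp: is_cf_expansion_def)
      have val: "cf_value as = of_int (int b) / of_int r"
        using as by (simp add: is_cf_expansion_def)
      have gt1: "cf_value as > 1"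
      proof -
        have "(of_int r :: rat) > 0" "(of_int r :: rat) < of_int (int b)"
          using r False by (simp_all only: of_int_0_less_iff of_int_less_iff)
        thus ?thesis unfolding val by simp
      qed
      have "d \<ge> 1"
      proof (cases "ds = []")
        case True
        thus ?thesis using gt1 ds by simp
      next
        case ne: False
        have "cf_value ds \<ge> 1"
          using ne as ds by (intro cf_value_ge_1) (auto simp: is_cf_expansion_def)
        hence "1 / cf_value ds \<le> 1" by simp
        hence "(of_int d :: rat) > 0" using gt1 cf_value_Cons[OF ne, of d] ds by simp
        thus ?thesis by simp
      qed
      hence "\<forall>e\<in>set as. e \<ge> 1" using as ds by (auto simp: is_cf_expansion_def)
      moreover have "cf_value (c # as) = of_int a / of_int (int b)"
      proof -
        have "cf_value (c # as) = of_int c + of_int r / of_int (int b)"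
          using val by (simp add: cf_value_Cons ds)
        also have "\<dots> = (of_int c * of_int (int b) + of_int r) / of_int (int b)"
          using less.prems by (simp add: add_divide_distrib)
        finally show ?thesis unfolding a by simp
      qed
      ultimately have "is_cf_expansion (c # as) (of_int a / of_int (int b))"
        by (simp add: is_cf_expansion_def)
      thus ?thesis by blast
    qed
  qed
  obtain a b where "quotient_of x = (a, b)" by fastforce
  hence "b > 0" "x = of_int a / of_int b"
    using quotient_of_denom_pos quotient_of_div by auto
  thus ?thesis using *[of "nat b" a] by simp
qed

lemma cf_value_eq_1D:
  assumes "as \<noteq> []" "\<forall>a\<in>set as. a \<ge> 1" "cf_value as = 1"
  shows "as = [1]"
proof -
  obtain b bs where as: "as = b # bs" using assms(1) by (cases as) auto
  show ?thesis
  proof (cases "bs = []")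
    case True thus ?thesis using assms as by simp
  next
    case False
    hence "1 / cf_value bs > 0" using cf_value_ge_1[of bs] assms(2) as by auto
    moreover have "(of_int b :: rat) \<ge> 1" using assms as by simp
    ultimately show ?thesis using assms(3) unfolding as cf_value_Cons[OF False] by linarith
  qed
qed

lemma q_int_add_one:
  assumes "q \<noteq> 0" "q \<noteq> (1::'a::field)"
  shows "q_int q (a + 1) = q_int q a + q powi a"
proof -
  have "q_int q a + q powi a = (1 - q powi a + q powi a * (1 - q)) / (1 - q)"
    using assms by (simp add: q_int_def add_divide_distrib)
  also have "1 - q powi a + q powi a * (1 - q) = 1 - q powi (a + 1)"
    using assms by (simp add: power_int_add algebra_simps)
  finally show ?thesis by (simp add: q_int_def)
qed

lemma q_cf_singleton_eq:
  assumes q: "q \<noteq> 0" "q \<noteq> (1::'a::field)"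
    and "bs \<noteq> []" "\<forall>c\<in>set bs. c \<ge> 1" "of_int a = of_int b + 1 / cf_value bs"
  shows "q_cf q (b # bs) = q_int q a"
proof -
  have ge: "cf_value bs \<ge> 1" by (rule cf_value_ge_1) fact+
  hence "0 < 1 / cf_value bs" "1 / cf_value bs \<le> 1" by auto
  hence "(of_int b :: rat) < of_int a" "(of_int a :: rat) \<le> of_int (b + 1)"
    using assms(5) by simp_all
  hence ab: "a = b + 1" unfolding of_int_less_iff of_int_le_iff by linarith
  hence "1 / cf_value bs = 1" using assms(5) unfolding of_int_add of_int_1 ab by linarith
  hence "cf_value bs = 1" by simp
  hence bs: "bs = [1]" using assms cf_value_eq_1D by blast
  have "q_int (1 / q) 1 = 1" using q by (simp add: q_int_def)
  thus ?thesis using q by (simp add: bs ab q_int_add_one)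
qed

lemma q_cf_unique:
  assumes "q \<noteq> 0" "q \<noteq> (1::'a::field)"
    and "as \<noteq> []" "\<forall>a\<in>set (tl as). a \<ge> 1"
    and "bs \<noteq> []" "\<forall>b\<in>set (tl bs). b \<ge> 1"
    and "cf_value as = cf_value bs"
  shows "q_cf q as = q_cf q bs"
  using assms
proof (induction as arbitrary: q bs)
  case (Cons a as)
  obtain b bs' where bs: "bs = b # bs'" using Cons.prems by (cases bs) auto
  note q = Cons.prems(1,2)
  have eq: "cf_value (a # as) = cf_value (b # bs')" using Cons.prems bs by simp
  consider "as = []" "bs' = []" | "as = []" "bs' \<noteq> []" | "as \<noteq> []" "bs' = []"
    | "as \<noteq> []" "bs' \<noteq> []" by blast
  thus ?case
  proof cases
    case 1
    thus ?thesis using eq bs by simp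
  next
    case 2
    thus ?thesis using q_cf_singleton_eq[OF q, of bs' a b] eq Cons.prems bs
      by (simp add: cf_value_Cons)
  next
    case 3
    thus ?thesis using q_cf_singleton_eq[OF q, of as b a] eq Cons.prems bs
      by (simp add: cf_value_Cons)
  next
    case 4
    have A: "\<forall>c\<in>set as. c \<ge> 1" and B: "\<forall>c\<in>set bs'. c \<ge> 1" using Cons.prems bs by auto
    have ga: "cf_value as \<ge> 1" and gb: "cf_value bs' \<ge> 1"
      using 4 A B cf_value_ge_1 by blast+
    hence bounds: "0 < 1 / cf_value as" "1 / cf_value as \<le> 1"
      "0 < 1 / cf_value bs'" "1 / cf_value bs' \<le> 1" by auto
    have eq': "of_int a + 1 / cf_value as = of_int b + 1 / cf_value bs'"
      using eq 4 by (simp add: cf_value_Cons)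
    have "(of_int a :: rat) < of_int (b + 1)" "(of_int b :: rat) < of_int (a + 1)"
      using bounds eq' unfolding of_int_add of_int_1 by linarith+
    hence ab: "a = b" unfolding of_int_less_iff by linarith
    hence "cf_value as = cf_value bs'" using eq' by simp
    moreover have "\<forall>c\<in>set (tl as). c \<ge> 1" "\<forall>c\<in>set (tl bs'). c \<ge> 1"
      using A B by (auto dest: list.set_sel(2)[rotated] simp: 4)
    ultimately have "q_cf (1 / q) as = q_cf (1 / q) bs'"
      using Cons.IH[of "1 / q" bs'] 4 q by simp
    thus ?thesis using 4 ab bs by (simp add: q_cf_Cons)
  qed
qed simp

lemma q_rat_eq:
  assumes "is_cf_expansion as x"
  shows "q_rat x = q_cf ratfun_var as"
proof -
  have "is_cf_expansion (SOME as. is_cf_expansion as x) x"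
    by (rule someI) fact
  moreover have "ratfun_var \<noteq> 0" "ratfun_var \<noteq> 1"
    by (simp_all add: ratfun_var_def Zero_fract_def One_fract_def eq_fract one_pCons
        del: pCons_one)
  ultimately show ?thesis
    using assms unfolding q_rat_def is_cf_expansion_def by (intro q_cf_unique) auto
qed

subsection \<open>The terms of the formula\<close>

definition thomae :: "real \<Rightarrow> real" where
  "thomae x = (if x \<in> \<rat>
     then 1 / of_int (THE b. b > 0 \<and> (\<exists>a::int. coprime a b \<and> x = of_int a / of_int b))
     else 0)"

definition F_fun :: "real \<Rightarrow> real" where
  "F_fun x = 1/3 * x^3 - x^2 + 5/3 * x - 1"

definition G_fun :: "real \<Rightarrow> real" where
  "G_fun x = 1 - x"

definition H_fun :: "real \<Rightarrow> real" where
  "H_fun x = x^2 * (1 - x)"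

text \<open>The first argument of \<open>modular_inverse\<close> is the modulus.\<close>

definition bracket :: "int \<Rightarrow> int \<Rightarrow> int \<Rightarrow> real" where
  "bracket n a b = of_int ((n * modular_inverse b a) mod b) / of_int b - 1/2"

end

theory Submission
  imports Defs
begin

text \<open>
  Write \<open>x = a / b\<close>, and let \<open>D\<^sub>1 x\<close>, \<open>D\<^sub>2 x\<close> be the first two derivatives of \<open>[x]\<^sub>q\<close> at
  \<open>q = 1\<close>. A continued fraction is built from the integer \<open>0\<close> by the two operations
  \<open>[x + c]\<^sub>q = [c]\<^sub>q + q\<^sup>c [x]\<^sub>q\<close> and \<open>[1 / y]\<^sub>q = 1 / [y]\<close> with \<open>q\<close> replaced by \<open>1 / q\<close> on the
  right. Hence \<open>D\<^sub>1\<close> and \<open>D\<^sub>2\<close> are determined by what these operations do to a second-order Taylor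
  expansion, and it suffices to find closed forms that obey the same rules. For the first derivative
  this is \<open>D\<^sub>1 x = (x\<^sup>2 - x + 1 - 1 / b\<^sup>2) / 2\<close>, an easy check.

  For the second derivative the rules are
  \<^item> \<open>D\<^sub>2 (x + c) = c (c - 1) (c - 2) / 3 + c (c - 1) x + 2 c D\<^sub>1 x + D\<^sub>2 x\<close>,
  \<^item> \<open>D\<^sub>2 (1 / y) = 2 (D\<^sub>1 y)\<^sup>2 / y\<^sup>3 - (D\<^sub>2 y + 2 D\<^sub>1 y) / y\<^sup>2\<close>.

  The bracket sum depends only on \<open>a\<close> modulo \<open>b\<close>, and the polynomial \<open>F + G / b\<^sup>2\<close> absorbs the
  first rule. The second rule asks for a reciprocity law between the bracket sums for \<open>(a, b)\<close> and
  \<open>(b, a)\<close>. Substituting \<open>n = a m\<close> and splitting off the part of \<open>H\<close> that is even under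
  \<open>x \<mapsto> 1 - x\<close>, the bracket sum becomes a multiple of the Dedekind-type sum of \<open>m B\<^sub>3 ({a m / b})\<close>
  over \<open>0 \<le> m < b\<close> (\<open>sum_bracket_H\<close>), where \<open>B\<^sub>3\<close> is the third Bernoulli polynomial. Its reciprocity
  law is due to Apostol; here it is obtained by summing over the lattice points of the triangle
  \<open>a m + b l < a b\<close> in two ways (\<open>apostol_reciprocity\<close>). The induction over the continued fraction is
  \<open>jet_q_cf\<close>.
\<close>

(* A field that is also a Euclidean ring satisfies these rules, and there they undo divide_simps. *)
declare div_add [simp del] div_diff [simp del] div_mult_self1 [simp del] div_mult_self2 [simp del]
  div_mult_self3 [simp del] div_mult_self4 [simp del]

section \<open>Sums over integer intervals\<close>

lemma sum_telescope_int:
  fixes f g :: "int \<Rightarrow> 'a::ab_group_add"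
  assumes "n \<ge> 0" and "\<And>m. f (m + 1) - f m = g m"
  shows "(\<Sum>m = 0..<n. g m) = f n - f 0"
  using assms(1)
proof (induction n rule: int_ge_induct)
  case (step n)
  have "{0..<n + 1} = insert n {0..<n}" using step.hyps by auto
  thus ?case using step assms(2)[of n] by (simp add: algebra_simps)
qed simp


text \<open>The summation range \<open>-n, \<dots>, -1\<close> is the one that occurs below. Each closed form comes from
  the polynomial \<open>p\<close> with \<open>p (m + 1) - p m = m ^ k\<close>, evaluated at \<open>0\<close> and \<open>-n\<close>.\<close>

lemma power_sums_shifted:
  fixes n :: int
  assumes "n \<ge> 0"
  shows "(\<Sum>m = 0..<n. real_of_int m - of_int n) = - (of_int n * (of_int n + 1) / 2)"
    and "(\<Sum>m = 0..<n. (real_of_int m - of_int n) ^ 2) = of_int n * (of_int n + 1) * (2 * of_int n + 1) / 6"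
    and "(\<Sum>m = 0..<n. (real_of_int m - of_int n) ^ 3) = - ((of_int n * (of_int n + 1) / 2) ^ 2)"
    and "(\<Sum>m = 0..<n. (real_of_int m - of_int n) ^ 4)
      = of_int n * (of_int n + 1) * (2 * of_int n + 1) * (3 * of_int n ^ 2 + 3 * of_int n - 1) / 30"
proof -
  have shift: "(\<Sum>m = 0..<n. (real_of_int m - of_int n) ^ k) = p 0 - p (- of_int n)"
    if "\<And>x. p (x + 1) - p x = x ^ k" for p :: "real \<Rightarrow> real" and k
  proof -
    have "p (of_int (m + 1) - of_int n) - p (of_int m - of_int n) = (real_of_int m - of_int n) ^ k" for m
      using that[of "of_int m - of_int n"] by (simp add: add_diff_eq diff_add_eq)
    from sum_telescope_int[OF assms, of "\<lambda>m. p (of_int m - of_int n)", OF this]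
    show ?thesis by simp
  qed
  show "(\<Sum>m = 0..<n. real_of_int m - of_int n) = - (of_int n * (of_int n + 1) / 2)"
    using shift[of "\<lambda>x. x * (x - 1) / 2" 1] by (simp add: field_simps)
  have "((x + 1) - 1) * (x + 1) * (2 * (x + 1) - 1) / 6 - (x - 1) * x * (2 * x - 1) / 6 = x ^ 2" for x :: real
    by (simp add: divide_simps) algebra
  from shift[of "\<lambda>x. (x - 1) * x * (2 * x - 1) / 6", OF this]
  show "(\<Sum>m = 0..<n. (real_of_int m - of_int n) ^ 2) = of_int n * (of_int n + 1) * (2 * of_int n + 1) / 6"
    by (rule trans) (simp add: field_simps power2_eq_square power4_eq_xxxx)
  have "((x + 1) * ((x + 1) - 1) / 2) ^ 2 - (x * (x - 1) / 2) ^ 2 = x ^ 3" for x :: real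
    by (simp add: divide_simps) algebra
  from shift[of "\<lambda>x. (x * (x - 1) / 2) ^ 2", OF this]
  show "(\<Sum>m = 0..<n. (real_of_int m - of_int n) ^ 3) = - ((of_int n * (of_int n + 1) / 2) ^ 2)"
    by (rule trans) (simp add: field_simps power2_eq_square power4_eq_xxxx)
  have "((x + 1) - 1) * (x + 1) * (2 * (x + 1) - 1) * (3 * (x + 1) ^ 2 - 3 * (x + 1) - 1) / 30
      - (x - 1) * x * (2 * x - 1) * (3 * x ^ 2 - 3 * x - 1) / 30 = x ^ 4" for x :: real
    by (simp add: divide_simps) algebra
  from shift[of "\<lambda>x. (x - 1) * x * (2 * x - 1) * (3 * x ^ 2 - 3 * x - 1) / 30", OF this]
  show "(\<Sum>m = 0..<n. (real_of_int m - of_int n) ^ 4)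
      = of_int n * (of_int n + 1) * (2 * of_int n + 1) * (3 * of_int n ^ 2 + 3 * of_int n - 1) / 30"
    by (rule trans) (simp add: field_simps power2_eq_square power4_eq_xxxx)
qed

lemma bij_betw_mult_mod:
  fixes a b :: int
  assumes "b > 0" "coprime a b"
  shows "bij_betw (\<lambda>m. a * m mod b) {0..<b} {0..<b}"
proof -
  have "inj_on (\<lambda>m. a * m mod b) {0..<b}"
  proof (rule inj_onI)
    fix x y assume xy: "x \<in> {0..<b}" "y \<in> {0..<b}" "a * x mod b = a * y mod b"
    hence "[x = y] (mod b)"
      using assms(2) cong_mult_lcancel[of a b x y] by (simp add: cong_def)
    thus "x = y" using xy by (auto simp: cong_def)
  qed
  moreover have "(\<lambda>m. a * m mod b) ` {0..<b} \<subseteq> {0..<b}" using assms by auto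
  ultimately show ?thesis
    unfolding bij_betw_def using endo_inj_surj[of "{0..<b}"] by blast
qed

section \<open>A reciprocity law for cubic Dedekind sums\<close>

text \<open>Twice the third Bernoulli polynomial, since the factor 2 clears its denominators.\<close>

definition cubic :: "real \<Rightarrow> real" where
  "cubic x = x * (x - 1) * (2 * x - 1)"

definition apostol_sum :: "int \<Rightarrow> int \<Rightarrow> real" where
  "apostol_sum a b = (\<Sum>m = 0..<b. of_int m * cubic (of_int (a * m mod b) / of_int b))"

lemma apostol_sum_periodic: "apostol_sum (a + c * b) b = apostol_sum a b"
proof -
  have "(a + c * b) * m = a * m + c * m * b" for m by (simp add: algebra_simps)
  hence "(a + c * b) * m mod b = a * m mod b" for m by simp
  thus ?thesis by (simp add: apostol_sum_def)
qed

text \<open>The numbers \<open>a m + b l - a b\<close> with \<open>l \<ge> 0\<close> climb in steps of \<open>b\<close>, and the sum stops below \<open>0\<close>.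
  The first nonnegative number in this progression is the residue of \<open>a m\<close> modulo \<open>b\<close>; this is how fractional
  parts enter when a difference \<open>Q (w + b) - Q w\<close> is telescoped.\<close>

lemma line_sum:
  fixes a b m :: int and Q g :: "real \<Rightarrow> real"
  assumes step: "\<And>w. Q (w + of_int b) - Q w = g w" and "a > 0" "b > 0" "0 \<le> m" "m < b"
  shows "(\<Sum>l = 0..<a. if a * m + b * l < a * b then g (of_int (a * m + b * l - a * b)) else 0)
    = Q (of_int (a * m mod b)) - Q (of_int (a * m - a * b))"
proof -
  define k where "k = a - a * m div b"
  define r where "r = a * m mod b"
  have am: "a * m = b * (a - k) + r" by (simp add: k_def r_def)
  have r: "0 \<le> r" "r < b" using assms(3) by (simp_all add: r_def)
  have iff: "a * m + b * l < a * b \<longleftrightarrow> l < k" for l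
  proof
    assume "l < k"
    hence "b * (l + 1) \<le> b * k" using assms(3) by (intro mult_left_mono) auto
    thus "a * m + b * l < a * b" using r by (simp add: am algebra_simps)
  next
    assume *: "a * m + b * l < a * b"
    have "r + b * l < b * k" using * by (simp add: am algebra_simps)
    hence "b * l < b * k" using r by linarith
    thus "l < k" using assms(3) by (simp only: mult_less_cancel_left_pos)
  qed
  have "k \<le> a" using assms(2-4) by (simp add: k_def pos_imp_zdiv_nonneg_iff)
  moreover have "k > 0" using iff[of 0] assms(2,5) by simp
  ultimately have k: "0 \<le> k" "k \<le> a" by simp_all
  have "(\<Sum>l = 0..<a. if a * m + b * l < a * b then g (of_int (a * m + b * l - a * b)) else 0)
      = (\<Sum>l = 0..<k. g (of_int (a * m + b * l - a * b)))"
    using k by (intro sum.mono_neutral_cong_right) (auto simp: iff)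
  also have "\<dots> = Q (of_int (a * m + b * k - a * b)) - Q (of_int (a * m + b * 0 - a * b))"
  proof (rule sum_telescope_int)
    show "Q (of_int (a * m + b * (l + 1) - a * b)) - Q (of_int (a * m + b * l - a * b))
        = g (of_int (a * m + b * l - a * b))" for l
      unfolding step[symmetric] by (simp add: algebra_simps)
  qed (use k in simp)
  also have "a * m + b * k - a * b = r"
    by (simp add: am algebra_simps)
  finally show ?thesis by (simp add: r_def)
qed

text \<open>The weight \<open>6 w\<^sup>2\<close> is the difference, in steps of \<open>b\<close>, of \<open>b\<^sup>2 cubic (w / b)\<close>. As it does not
  mention \<open>b\<close>, the same sum with \<open>l\<close> in place of \<open>m\<close> produces the Dedekind sum with the roles of
  \<open>a\<close> and \<open>b\<close> exchanged.\<close>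

lemma triangle_sum:
  fixes a b :: int
  assumes "a > 0" "b > 0"
  shows "(\<Sum>m = 0..<b. \<Sum>l = 0..<a. if a * m + b * l < a * b
      then real_of_int m * (6 * (of_int (a * m + b * l - a * b))\<^sup>2) else 0)
    = of_int b ^ 2 * (apostol_sum a b - (\<Sum>m = 0..<b. of_int m * cubic (of_int (a * m - a * b) / of_int b)))"
proof -
  define Q where "Q = (\<lambda>w. of_int b ^ 2 * cubic (w / of_int b))"
  have step: "Q (w + of_int b) - Q w = 6 * w\<^sup>2" for w
    using assms by (simp add: Q_def cubic_def divide_simps) algebra
  have "(\<Sum>m = 0..<b. \<Sum>l = 0..<a. if a * m + b * l < a * b
      then real_of_int m * (6 * (of_int (a * m + b * l - a * b))\<^sup>2) else 0)
    = (\<Sum>m = 0..<b. of_int m * (\<Sum>l = 0..<a. if a * m + b * l < a * b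
      then 6 * (of_int (a * m + b * l - a * b))\<^sup>2 else 0))"
    unfolding sum_distrib_left by (intro sum.cong) auto
  also have "\<dots> = (\<Sum>m = 0..<b. of_int m * (Q (of_int (a * m mod b)) - Q (of_int (a * m - a * b))))"
    using assms by (intro sum.cong refl arg_cong2[of _ _ _ _ "(*)"] line_sum step) auto
  also have "\<dots> = of_int b ^ 2 * (apostol_sum a b
      - (\<Sum>m = 0..<b. of_int m * cubic (of_int (a * m - a * b) / of_int b)))"
    unfolding apostol_sum_def Q_def right_diff_distrib sum_subtractf sum_distrib_left
    by (simp add: mult.left_commute)
  finally show ?thesis .
qed

text \<open>Put \<open>w = a m + b l - a b\<close>. Adding \<open>a\<close> times the triangle sum for \<open>m\<close> to \<open>b\<close> times the one for
  \<open>l\<close> gives the weight \<open>(a m + b l) 6 w\<^sup>2 = (w + a b) 6 w\<^sup>2\<close>, which depends on the point only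
  through \<open>w\<close>. So it telescopes along each line as well, but now without a factor \<open>m\<close>: the residues
  of \<open>a m\<close> run through \<open>0, \<dots>, b - 1\<close> in some order, and only power sums are left.\<close>

lemma apostol_reciprocity:
  fixes a b :: int
  assumes "a > 0" "b > 0" "coprime a b"
  shows "of_int a * of_int b ^ 2 * apostol_sum a b + of_int b * of_int a ^ 2 * apostol_sum b a
    = - (of_int a ^ 4 + of_int b ^ 4 - 5 * of_int a ^ 2 * of_int b ^ 2 + 3) / 60"
proof -
  define A B :: real where "A = of_int a" and "B = of_int b"
  have pos: "A > 0" "B > 0" using assms by (simp_all add: A_def B_def)
  define U where "U = (\<lambda>a b. \<Sum>m = 0..<b. of_int m * cubic (of_int (a * m - a * b) / of_int b))"
  define w where "w = (\<lambda>m l. real_of_int (a * m + b * l - a * b))"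
  have w: "w m l + A * B = A * of_int m + B * of_int l" for m l
    by (simp add: w_def A_def B_def)
  \<comment> \<open>the antidifference of \<open>(x + A * B) * (6 * x\<^sup>2)\<close> for steps of \<open>B\<close>\<close>
  define P where "P = (\<lambda>x. 3/2 * x\<^sup>2 * (x - B)\<^sup>2 / B + A * x * (x - B) * (2 * x - B))"
  have P_step: "P (x + of_int b) - P x = (x + A * B) * (6 * x\<^sup>2)" for x
    unfolding P_def B_def[symmetric] using pos by (simp add: divide_simps) algebra

  have "A * (B\<^sup>2 * (apostol_sum a b - U a b)) + B * (A\<^sup>2 * (apostol_sum b a - U b a))
      = A * (\<Sum>m = 0..<b. \<Sum>l = 0..<a. if a * m + b * l < a * b then of_int m * (6 * (w m l)\<^sup>2) else 0)
      + B * (\<Sum>m = 0..<b. \<Sum>l = 0..<a. if a * m + b * l < a * b then of_int l * (6 * (w m l)\<^sup>2) else 0)"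
    (is "?lhs = A * ?X + B * ?Y")
  proof -
    have "?X = B\<^sup>2 * (apostol_sum a b - U a b)"
      using triangle_sum[OF assms(1,2)] unfolding U_def w_def B_def .
    moreover have "?Y = A\<^sup>2 * (apostol_sum b a - U b a)"
      using triangle_sum[OF assms(2,1)] unfolding U_def w_def A_def
      by - (rule trans[OF sum.swap], simp only: add.commute[of "b * _"] mult.commute[of b a])
    ultimately show ?thesis by simp
  qed
  also have "\<dots> = (\<Sum>m = 0..<b. \<Sum>l = 0..<a. if a * m + b * l < a * b
      then (w m l + A * B) * (6 * (w m l)\<^sup>2) else 0)"
    unfolding sum_distrib_left sum.distrib[symmetric]
    by (intro sum.cong refl) (simp add: w distrib_right mult.assoc)
  also have "\<dots> = (\<Sum>m = 0..<b. P (of_int (a * m mod b)) - P (of_int (a * m - a * b)))"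
    unfolding w_def using assms by (intro sum.cong refl line_sum P_step) auto
  also have "\<dots> = (\<Sum>m = 0..<b. P (of_int m)) - (\<Sum>m = 0..<b. P (of_int (a * m - a * b)))"
    unfolding sum_subtractf
    using sum.reindex_bij_betw[OF bij_betw_mult_mod[OF assms(2,3)], of "\<lambda>r. P (of_int r)"] by simp
  finally have main: "A * B\<^sup>2 * apostol_sum a b + B * A\<^sup>2 * apostol_sum b a
      = (\<Sum>m = 0..<b. P (of_int m)) - (\<Sum>m = 0..<b. P (of_int (a * m - a * b)))
        + A * B\<^sup>2 * U a b + B * A\<^sup>2 * U b a"
    by (simp add: algebra_simps)

  have "(\<Sum>m = 0..<b. P (of_int m)) - (\<Sum>m = 0..<b. P (of_int (a * m - a * b))) + A * B\<^sup>2 * U a b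
      = (\<Sum>m = 0..<b. P (of_int m) - P (of_int (a * m - a * b))
         + A * B\<^sup>2 * (of_int m * cubic (of_int (a * m - a * b) / of_int b)))"
    by (simp add: U_def sum.distrib sum_subtractf sum_distrib_left)
  also have "\<dots> = (\<Sum>m = 0..<b. (3/2 / B + A^4 / (2 * B)) * (real_of_int m - of_int b) ^ 4
      + (3 + 2 * A) * (real_of_int m - of_int b) ^ 3
      + (3/2 * B + 3 * A * B - A\<^sup>2 * B / 2) * (real_of_int m - of_int b) ^ 2
      + A * B\<^sup>2 * (real_of_int m - of_int b))"
  proof (intro sum.cong refl)
    fix m
    define j where "j = real_of_int m - B"
    have m: "real_of_int m = j + B" "real_of_int (a * m - a * b) = A * j"
      by (simp_all add: j_def A_def B_def algebra_simps)
    show "P (of_int m) - P (of_int (a * m - a * b))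
         + A * B\<^sup>2 * (of_int m * cubic (of_int (a * m - a * b) / of_int b))
        = (3/2 / B + A^4 / (2 * B)) * (real_of_int m - of_int b) ^ 4
      + (3 + 2 * A) * (real_of_int m - of_int b) ^ 3
      + (3/2 * B + 3 * A * B - A\<^sup>2 * B / 2) * (real_of_int m - of_int b) ^ 2
      + A * B\<^sup>2 * (real_of_int m - of_int b)"
      unfolding m B_def[symmetric] P_def cubic_def using pos
      by (simp add: divide_simps) algebra
  qed
  also have "\<dots> = (3/2 / B + A^4 / (2 * B)) * (B * (B + 1) * (2 * B + 1) * (3 * B ^ 2 + 3 * B - 1) / 30)
      + (3 + 2 * A) * (- ((B * (B + 1) / 2) ^ 2))
      + (3/2 * B + 3 * A * B - A\<^sup>2 * B / 2) * (B * (B + 1) * (2 * B + 1) / 6)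
      + A * B\<^sup>2 * (- (B * (B + 1) / 2))"
    unfolding sum.distrib sum_distrib_left[symmetric] B_def
    using assms by (simp only: power_sums_shifted less_imp_le)
  finally have first: "(\<Sum>m = 0..<b. P (of_int m)) - (\<Sum>m = 0..<b. P (of_int (a * m - a * b)))
      + A * B\<^sup>2 * U a b = \<dots>" .

  have "B * A\<^sup>2 * U b a
      = (\<Sum>l = 0..<a. B * A\<^sup>2 * (of_int l * cubic (of_int (b * l - b * a) / of_int a)))"
    by (simp add: U_def sum_distrib_left)
  also have "\<dots> = (\<Sum>l = 0..<a. 2 * B^4 / A * (real_of_int l - of_int a) ^ 4
      + (2 * B^4 - 3 * B^3) * (real_of_int l - of_int a) ^ 3
      + (A * B\<^sup>2 - 3 * A * B^3) * (real_of_int l - of_int a) ^ 2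
      + A\<^sup>2 * B\<^sup>2 * (real_of_int l - of_int a))"
  proof (intro sum.cong refl)
    fix l
    define j where "j = real_of_int l - A"
    have l: "real_of_int l = j + A" "real_of_int (b * l - b * a) = B * j"
      by (simp_all add: j_def A_def B_def algebra_simps)
    show "B * A\<^sup>2 * (of_int l * cubic (of_int (b * l - b * a) / of_int a))
      = 2 * B^4 / A * (real_of_int l - of_int a) ^ 4
      + (2 * B^4 - 3 * B^3) * (real_of_int l - of_int a) ^ 3
      + (A * B\<^sup>2 - 3 * A * B^3) * (real_of_int l - of_int a) ^ 2
      + A\<^sup>2 * B\<^sup>2 * (real_of_int l - of_int a)"
      unfolding l A_def[symmetric] cubic_def using pos
      by (simp add: divide_simps) algebra
  qed
  also have "\<dots> = 2 * B^4 / A * (A * (A + 1) * (2 * A + 1) * (3 * A ^ 2 + 3 * A - 1) / 30)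
      + (2 * B^4 - 3 * B^3) * (- ((A * (A + 1) / 2) ^ 2))
      + (A * B\<^sup>2 - 3 * A * B^3) * (A * (A + 1) * (2 * A + 1) / 6)
      + A\<^sup>2 * B\<^sup>2 * (- (A * (A + 1) / 2))"
    unfolding sum.distrib sum_distrib_left[symmetric] A_def
    using assms by (simp only: power_sums_shifted less_imp_le)
  finally have second: "B * A\<^sup>2 * U b a = \<dots>" .

  show ?thesis
    unfolding A_def[symmetric] B_def[symmetric] main second first
    using pos by (simp add: divide_simps) algebra
qed

section \<open>Second-order Taylor data of a rational function at 1\<close>

text \<open>The number \<open>x\<close> and the derivatives \<open>d\<close>, \<open>e\<close> are pinned down by Leibniz' rule for
  \<open>N = R * D\<close>. In this form the sum, product and inverse rules are identities between values of
  polynomials at \<open>1\<close>, and a common zero of numerator and denominator elsewhere does no harm.\<close>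

definition jet :: "ratfun \<Rightarrow> real \<Rightarrow> real \<Rightarrow> real \<Rightarrow> bool" where
  "jet R x d e \<longleftrightarrow> (\<exists>N D. R = Fract N D \<and> poly D 1 \<noteq> 0 \<and> poly N 1 = x * poly D 1
     \<and> poly (pderiv N) 1 = d * poly D 1 + x * poly (pderiv D) 1
     \<and> poly (pderiv (pderiv N)) 1
       = e * poly D 1 + 2 * d * poly (pderiv D) 1 + x * poly (pderiv (pderiv D)) 1)"

lemma jetI:
  assumes "R = Fract N D" "poly D 1 \<noteq> 0" "poly N 1 = x * poly D 1"
    "poly (pderiv N) 1 = d * poly D 1 + x * poly (pderiv D) 1"
    "poly (pderiv (pderiv N)) 1
      = e * poly D 1 + 2 * d * poly (pderiv D) 1 + x * poly (pderiv (pderiv D)) 1"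
  shows "jet R x d e"
  unfolding jet_def using assms by blast

lemma jet_eqI: "jet R x d e \<Longrightarrow> x = x' \<Longrightarrow> d = d' \<Longrightarrow> e = e' \<Longrightarrow> jet R x' d' e'"
  by simp

lemma jetE:
  assumes "jet R x d e"
  obtains N D where "R = Fract N D" "D \<noteq> 0" "poly D 1 \<noteq> 0" "poly N 1 = x * poly D 1"
    "poly (pderiv N) 1 = d * poly D 1 + x * poly (pderiv D) 1"
    "poly (pderiv (pderiv N)) 1
      = e * poly D 1 + 2 * d * poly (pderiv D) 1 + x * poly (pderiv (pderiv D)) 1"
proof -
  from assms obtain N D where "R = Fract N D" "poly D 1 \<noteq> 0" "poly N 1 = x * poly D 1"
    "poly (pderiv N) 1 = d * poly D 1 + x * poly (pderiv D) 1"
    "poly (pderiv (pderiv N)) 1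
      = e * poly D 1 + 2 * d * poly (pderiv D) 1 + x * poly (pderiv (pderiv D)) 1"
    unfolding jet_def by blast
  moreover from this have "D \<noteq> 0" by auto
  ultimately show ?thesis using that by blast
qed

lemma jet_0: "jet 0 0 0 0"
  unfolding jet_def by (rule exI[of _ 0], rule exI[of _ 1]) (simp add: Zero_fract_def)

lemma jet_1: "jet 1 1 0 0"
  unfolding jet_def by (rule exI[of _ 1], rule exI[of _ 1]) (simp add: One_fract_def)

lemma jet_ratfun_var: "jet ratfun_var 1 1 0"
  unfolding jet_def ratfun_var_def
  by (rule exI[of _ "[:0, 1:]"], rule exI[of _ 1]) (simp add: pderiv_pCons)

lemma jet_uminus:
  assumes "jet R x d e"
  shows "jet (- R) (- x) (- d) (- e)"
proof -
  from assms obtain N D where *: "R = Fract N D" "D \<noteq> 0" "poly D 1 \<noteq> 0" "poly N 1 = x * poly D 1"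
    "poly (pderiv N) 1 = d * poly D 1 + x * poly (pderiv D) 1"
    "poly (pderiv (pderiv N)) 1
      = e * poly D 1 + 2 * d * poly (pderiv D) 1 + x * poly (pderiv (pderiv D)) 1" by (rule jetE)
  show ?thesis
    unfolding jet_def by (rule exI[of _ "- N"], rule exI[of _ D]) (simp add: * pderiv_minus)
qed

lemma jet_add:
  assumes "jet R x d e" "jet R' x' d' e'"
  shows "jet (R + R') (x + x') (d + d') (e + e')"
proof -
  from assms(1) obtain N D where *: "R = Fract N D" "D \<noteq> 0" "poly D 1 \<noteq> 0"
    "poly N 1 = x * poly D 1"
    "poly (pderiv N) 1 = d * poly D 1 + x * poly (pderiv D) 1"
    "poly (pderiv (pderiv N)) 1
      = e * poly D 1 + 2 * d * poly (pderiv D) 1 + x * poly (pderiv (pderiv D)) 1" by (rule jetE)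
  from assms(2) obtain N' D' where **: "R' = Fract N' D'" "D' \<noteq> 0" "poly D' 1 \<noteq> 0"
    "poly N' 1 = x' * poly D' 1"
    "poly (pderiv N') 1 = d' * poly D' 1 + x' * poly (pderiv D') 1"
    "poly (pderiv (pderiv N')) 1
      = e' * poly D' 1 + 2 * d' * poly (pderiv D') 1 + x' * poly (pderiv (pderiv D')) 1"
    by (rule jetE)
  have "R + R' = Fract (N * D' + N' * D) (D * D')" using * ** by simp
  thus ?thesis
    by (rule jetI) (simp_all add: * ** pderiv_add pderiv_mult algebra_simps)
qed

lemma jet_mult:
  assumes "jet R x d e" "jet R' x' d' e'"
  shows "jet (R * R') (x * x') (d * x' + x * d') (e * x' + 2 * d * d' + x * e')"
proof -
  from assms(1) obtain N D where *: "R = Fract N D" "D \<noteq> 0" "poly D 1 \<noteq> 0"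
    "poly N 1 = x * poly D 1"
    "poly (pderiv N) 1 = d * poly D 1 + x * poly (pderiv D) 1"
    "poly (pderiv (pderiv N)) 1
      = e * poly D 1 + 2 * d * poly (pderiv D) 1 + x * poly (pderiv (pderiv D)) 1" by (rule jetE)
  from assms(2) obtain N' D' where **: "R' = Fract N' D'" "D' \<noteq> 0" "poly D' 1 \<noteq> 0"
    "poly N' 1 = x' * poly D' 1"
    "poly (pderiv N') 1 = d' * poly D' 1 + x' * poly (pderiv D') 1"
    "poly (pderiv (pderiv N')) 1
      = e' * poly D' 1 + 2 * d' * poly (pderiv D') 1 + x' * poly (pderiv (pderiv D')) 1"
    by (rule jetE)
  have "R * R' = Fract (N * N') (D * D')" using * ** by simp
  thus ?thesis
    by (rule jetI) (simp_all add: * ** pderiv_add pderiv_mult algebra_simps)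
qed

lemma jet_inverse:
  assumes "jet R x d e" "x \<noteq> 0"
  shows "jet (inverse R) (1 / x) (- d / x\<^sup>2) (2 * d\<^sup>2 / x ^ 3 - e / x\<^sup>2)"
proof -
  from assms(1) obtain N D where *: "R = Fract N D" "D \<noteq> 0" "poly D 1 \<noteq> 0"
    "poly N 1 = x * poly D 1"
    "poly (pderiv N) 1 = d * poly D 1 + x * poly (pderiv D) 1"
    "poly (pderiv (pderiv N)) 1
      = e * poly D 1 + 2 * d * poly (pderiv D) 1 + x * poly (pderiv (pderiv D)) 1" by (rule jetE)
  have "inverse R = Fract D N" using * by simp
  thus ?thesis
    by (rule jetI) (use assms(2) in \<open>simp_all add: * field_simps power2_eq_square power3_eq_cube\<close>)
qed

lemma jet_power_int:
  assumes "jet Q 1 d e" "Q \<noteq> 0"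
  shows "jet (Q powi n) 1 (of_int n * d) (of_int n * (of_int n - 1) * d\<^sup>2 + of_int n * e)"
proof (induction n rule: int_induct[where k = 0])
  case base
  show ?case using jet_1 by simp
next
  case (step1 n)
  have "Q powi (n + 1) = Q powi n * Q" using assms(2) by (simp add: power_int_add_1)
  thus ?case
    using jet_mult[OF step1(2) assms(1)]
    by (auto elim!: jet_eqI simp: algebra_simps power2_eq_square)
next
  case (step2 n)
  have "Q powi (n - 1) = Q powi n * inverse Q"
    using assms(2) by (simp add: power_int_diff divide_inverse)
  thus ?case
    using jet_mult[OF step2(2) jet_inverse[OF assms(1)]]
    by (auto elim!: jet_eqI simp: algebra_simps power2_eq_square)
qed

lemma jet_q_int:
  assumes "jet Q 1 d e" "Q \<noteq> 0" "Q \<noteq> 1"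
  shows "jet (q_int Q n) (of_int n) (of_int n * (of_int n - 1) / 2 * d)
    (of_int n * (of_int n - 1) * (of_int n - 2) / 3 * d\<^sup>2 + of_int n * (of_int n - 1) / 2 * e)"
proof (induction n rule: int_induct[where k = 0])
  case base
  show ?case using jet_0 by (simp add: q_int_def)
next
  case (step1 n)
  have "q_int Q (n + 1) = q_int Q n + Q powi n" using assms by (simp add: q_int_add_one)
  thus ?case
    using jet_add[OF step1(2) jet_power_int[OF assms(1,2)], of n]
    by (auto elim!: jet_eqI simp: field_simps power2_eq_square)
next
  case (step2 n)
  have "q_int Q (n - 1) = q_int Q n + - (Q powi (n - 1))"
    using assms q_int_add_one[of Q "n - 1"] by simp
  thus ?case
    by (simp only:, intro jet_eqI[OF jet_add[OF step2(2) jet_uminus[OF jet_power_int[OF assms(1,2)]]]])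
      (simp_all add: field_simps power2_eq_square)
qed

text \<open>The reduced denominator divides every denominator, so any representation with a nonzero
  denominator at \<open>t\<close> computes the value at \<open>t\<close>.\<close>

lemma ratfun_eval_Fract:
  assumes "poly D t \<noteq> 0"
  shows "ratfun_eval (Fract N D) t = poly N t / poly D t"
proof -
  obtain N0 D0 where q: "quot_of_fract (Fract N D) = (N0, D0)" by fastforce
  have "(N0, D0) \<in> normalized_fracts" unfolding q[symmetric] by simp
  hence cop: "coprime N0 D0" and "D0 \<noteq> 0" by (auto simp: normalized_fracts_def)
  have "Fract N D = quot_to_fract (N0, D0)" unfolding q[symmetric] by simp
  hence "Fract N D = Fract N0 D0" using \<open>D0 \<noteq> 0\<close> by (simp add: quot_to_fract_def)
  moreover have "D \<noteq> 0" using assms by auto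
  ultimately have eq: "N * D0 = N0 * D" using \<open>D0 \<noteq> 0\<close> by (simp add: eq_fract)
  hence "D0 dvd N0 * D" by (metis dvd_triv_right)
  hence "D0 dvd D" using cop by (simp add: coprime_commute coprime_dvd_mult_right_iff)
  hence "poly D0 t \<noteq> 0" using assms by (auto elim!: dvdE)
  moreover have "poly N t * poly D0 t = poly N0 t * poly D t"
    using arg_cong[OF eq, of "\<lambda>p. poly p t"] by simp
  ultimately show ?thesis using assms by (simp add: ratfun_eval_def q field_simps)
qed

lemma deriv2_ratfun_eval:
  assumes "jet R x d e"
  shows "(deriv ^^ 2) (ratfun_eval R) 1 = e"
proof -
  from assms obtain N D where *: "R = Fract N D" "D \<noteq> 0" "poly D 1 \<noteq> 0"
    "poly N 1 = x * poly D 1"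
    "poly (pderiv N) 1 = d * poly D 1 + x * poly (pderiv D) 1"
    "poly (pderiv (pderiv N)) 1
      = e * poly D 1 + 2 * d * poly (pderiv D) 1 + x * poly (pderiv (pderiv D)) 1" by (rule jetE)
  define f' where "f' = (\<lambda>t. (poly (pderiv N) t * poly D t - poly N t * poly (pderiv D) t)
    / (poly D t * poly D t))"
  have near: "\<forall>\<^sub>F s in nhds t. poly D s \<noteq> 0" if "poly D t \<noteq> 0" for t
  proof -
    have "open {s. poly D s \<noteq> 0}" by (intro open_Collect_neq continuous_intros)
    thus ?thesis using that unfolding eventually_nhds by blast
  qed
  have "deriv (ratfun_eval R) t = f' t" if "poly D t \<noteq> 0" for t
  proof -
    have "deriv (ratfun_eval R) t = deriv (\<lambda>s. poly N s / poly D s) t"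
      using near[OF that] by (intro deriv_cong_ev) (auto elim: eventually_mono simp: * ratfun_eval_Fract)
    also have "((\<lambda>s. poly N s / poly D s) has_real_derivative f' t) (at t)"
      unfolding f'_def using that by (auto intro!: derivative_eq_intros)
    hence "deriv (\<lambda>s. poly N s / poly D s) t = f' t" by (rule DERIV_imp_deriv)
    finally show ?thesis .
  qed
  hence "\<forall>\<^sub>F t in nhds 1. deriv (ratfun_eval R) t = f' t"
    using near[OF *(3)] by (auto elim: eventually_mono)
  hence "deriv (deriv (ratfun_eval R)) 1 = deriv f' 1" by (intro deriv_cong_ev) auto
  also have "deriv f' 1 = e"
  proof (rule DERIV_imp_deriv)
    have "(f' has_real_derivative
        ((poly (pderiv (pderiv N)) 1 * poly D 1 - poly N 1 * poly (pderiv (pderiv D)) 1)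
          * (poly D 1 * poly D 1)
         - (poly (pderiv N) 1 * poly D 1 - poly N 1 * poly (pderiv D) 1)
          * (2 * poly D 1 * poly (pderiv D) 1)) / (poly D 1 * poly D 1) ^ 2) (at 1)"
      unfolding f'_def using *(3) by (auto intro!: derivative_eq_intros simp: power2_eq_square)
    also have "((poly (pderiv (pderiv N)) 1 * poly D 1 - poly N 1 * poly (pderiv (pderiv D)) 1)
          * (poly D 1 * poly D 1)
         - (poly (pderiv N) 1 * poly D 1 - poly N 1 * poly (pderiv D) 1)
          * (2 * poly D 1 * poly (pderiv D) 1)) / (poly D 1 * poly D 1) ^ 2 = e"
      using *(3) by (simp add: *(4-6) field_simps power2_eq_square)
    finally show "(f' has_real_derivative e) (at 1)" .
  qed
  finally show ?thesis by (simp add: numeral_2_eq_2)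
qed

section \<open>The bracket sum as a Dedekind sum\<close>

lemma sum_odd_zero:
  fixes f :: "int \<Rightarrow> real"
  assumes "f 0 = 0" and "\<And>m. 0 < m \<Longrightarrow> m < b \<Longrightarrow> f (b - m) = - f m"
  shows "(\<Sum>m = 0..<b. f m) = 0"
proof -
  have eq: "(\<Sum>m = 0..<b. f m) = (\<Sum>m \<in> {0<..<b}. f m)"
    using assms(1) by (intro sum.mono_neutral_right) (auto simp: less_le)
  have "(\<Sum>m \<in> {0<..<b}. f m) = (\<Sum>m \<in> {0<..<b}. - f m)"
    by (rule sum.reindex_bij_witness[of _ "\<lambda>m. b - m" "\<lambda>m. b - m"]) (auto simp: assms(2))
  thus ?thesis unfolding eq by (simp add: sum_negf)
qed

lemma bracket_mult_mod:
  fixes a b m :: int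
  assumes "coprime a b" "0 \<le> m" "m < b"
  shows "bracket (a * m mod b) a b = of_int m / of_int b - 1 / 2"
proof -
  have "[a * m mod b * modular_inverse b a = a * m * modular_inverse b a] (mod b)"
    by (simp add: cong_def mod_mult_left_eq)
  also have "a * m * modular_inverse b a = (a * modular_inverse b a) * m" by simp
  also have "[(a * modular_inverse b a) * m = 1 * m] (mod b)"
    by (intro cong_mult cong_modular_inverse1 cong_refl assms)
  finally have "(a * m mod b * modular_inverse b a) mod b = m"
    using assms by (simp add: cong_def)
  thus ?thesis by (simp add: bracket_def)
qed

text \<open>After the substitution \<open>n = a m\<close> the bracket is \<open>m / b - 1 / 2\<close>, an odd function of \<open>m\<close> under
  \<open>m \<mapsto> b - m\<close>. Since \<open>H x = x (1 - x) / 2 - cubic x / 2\<close> with an even first and an odd second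
  summand under \<open>x \<mapsto> 1 - x\<close>, the first summand drops out, and so does the contribution of the
  constant \<open>1 / 2\<close> to the second one.\<close>

lemma sum_bracket_H:
  fixes a b :: int
  assumes "b > 0" "coprime a b"
  shows "(\<Sum>n = 1..b - 1. bracket n a b * H_fun (of_int n / of_int b))
    = - apostol_sum a b / (2 * of_int b)"
proof -
  define r where "r = (\<lambda>m. real_of_int (a * m mod b) / of_int b)"
  define f where "f = (\<lambda>m. (of_int m / of_int b - 1 / 2) * (r m * (1 - r m) / 2) + cubic (r m) / 4)"
  have "(\<Sum>m = 0..<b. f m) = 0"
  proof (rule sum_odd_zero)
    show "f 0 = 0" by (simp add: f_def r_def cubic_def)
    fix m assume m: "0 < m" "m < b"
    have "a * (b - m) mod b = (- (a * m)) mod b"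
      by (simp add: right_diff_distrib mod_diff_left_eq[symmetric])
    hence *: "a * (b - m) mod b = (if a * m mod b = 0 then 0 else b - a * m mod b)"
      by (simp add: zmod_zminus1_eq_if)
    show "f (b - m) = - f m"
    proof (cases "a * m mod b = 0")
      case True
      thus ?thesis using * by (simp add: f_def r_def cubic_def)
    next
      case False
      hence r: "r (b - m) = 1 - r m" using * assms(1) by (simp add: r_def diff_divide_distrib)
      show ?thesis using assms(1) unfolding f_def r cubic_def by (simp add: field_simps)
    qed
  qed
  moreover have "(of_int m / of_int b - 1 / 2) * H_fun (r m)
      = f m - of_int m * cubic (r m) / (2 * of_int b)" for m
    using assms(1) by (simp add: f_def H_fun_def cubic_def field_simps power2_eq_square)
  ultimately have "(\<Sum>m = 0..<b. (of_int m / of_int b - 1 / 2) * H_fun (r m))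
      = - apostol_sum a b / (2 * of_int b)"
    by (simp add: sum_subtractf apostol_sum_def r_def sum_divide_distrib)
  moreover have "(\<Sum>n = 1..b - 1. bracket n a b * H_fun (of_int n / of_int b))
      = (\<Sum>n = 0..<b. bracket n a b * H_fun (of_int n / of_int b))"
    by (intro sum.mono_neutral_left) (auto simp: H_fun_def)
  moreover have "\<dots> = (\<Sum>m = 0..<b. bracket (a * m mod b) a b * H_fun (r m))"
    unfolding r_def
    by (rule sum.reindex_bij_betw[OF bij_betw_mult_mod[OF assms], symmetric])
  moreover have "\<dots> = (\<Sum>m = 0..<b. (of_int m / of_int b - 1 / 2) * H_fun (r m))"
    using assms(2) by (intro sum.cong refl) (simp add: bracket_mult_mod)
  ultimately show ?thesis by simp
qed

section \<open>The derivatives of a q-rational\<close>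

text \<open>The closed forms for the first and second derivative of \<open>[a / b]\<^sub>q\<close> at \<open>q = 1\<close>. The factor
  \<open>- 10 / b\<close> is \<open>20\<close> times the factor \<open>- 1 / (2 b)\<close> of \<open>sum_bracket_H\<close>.\<close>

definition q_rat_deriv1 :: "int \<Rightarrow> int \<Rightarrow> real" where
  "q_rat_deriv1 a b = ((of_int a / of_int b)\<^sup>2 - of_int a / of_int b + 1 - 1 / (of_int b)\<^sup>2) / 2"

definition q_rat_deriv2 :: "int \<Rightarrow> int \<Rightarrow> real" where
  "q_rat_deriv2 a b = F_fun (of_int a / of_int b) + G_fun (of_int a / of_int b) / (of_int b)\<^sup>2
    - 10 / of_int b * apostol_sum a b"

lemma q_rat_deriv1_translate:
  assumes "b > 0"
  shows "q_rat_deriv1 (a + c * b) b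
    = of_int c * (of_int c - 1) / 2 + of_int c * (of_int a / of_int b) + q_rat_deriv1 a b"
proof -
  have "real_of_int (a + c * b) / of_int b = of_int a / of_int b + of_int c"
    using assms by (simp add: add_divide_distrib)
  thus ?thesis
    unfolding q_rat_deriv1_def by (simp only:) (simp add: power2_eq_square algebra_simps add_divide_distrib diff_divide_distrib)
qed

lemma q_rat_deriv2_translate:
  assumes "b > 0"
  shows "q_rat_deriv2 (a + c * b) b
    = of_int c * (of_int c - 1) * (of_int c - 2) / 3 + of_int c * (of_int c - 1) * (of_int a / of_int b)
      + 2 * of_int c * q_rat_deriv1 a b + q_rat_deriv2 a b"
proof -
  define x C u where "x = real_of_int a / of_int b" and "C = real_of_int c"
    and "u = 1 / (real_of_int b)\<^sup>2"
  have "real_of_int (a + c * b) / of_int b = x + C"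
    using assms by (simp add: add_divide_distrib x_def C_def)
  hence "q_rat_deriv2 (a + c * b) b = F_fun (x + C) + G_fun (x + C) * u - 10 / of_int b * apostol_sum a b"
    by (simp add: q_rat_deriv2_def apostol_sum_periodic u_def)
  moreover have "q_rat_deriv2 a b = F_fun x + G_fun x * u - 10 / of_int b * apostol_sum a b"
    by (simp add: q_rat_deriv2_def x_def u_def)
  moreover have "q_rat_deriv1 a b = (x\<^sup>2 - x + 1 - u) / 2" by (simp add: q_rat_deriv1_def x_def u_def)
  moreover have "F_fun (x + C) + G_fun (x + C) * u = C * (C - 1) * (C - 2) / 3 + C * (C - 1) * x
      + 2 * C * ((x\<^sup>2 - x + 1 - u) / 2) + (F_fun x + G_fun x * u)"
    by (simp add: F_fun_def G_fun_def field_simps power2_eq_square power3_eq_cube)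
  ultimately show ?thesis by (simp add: x_def[symmetric] C_def[symmetric])
qed

lemma q_rat_deriv1_invert:
  assumes "a > 0" "b > 0"
  shows "q_rat_deriv1 a b = q_rat_deriv1 b a / (of_int b / of_int a)\<^sup>2"
  using assms by (simp add: q_rat_deriv1_def field_simps power2_eq_square)

text \<open>Multiplied by \<open>b / a\<close>, the two Dedekind sums occur in the symmetric combination of the
  reciprocity law; everything else is a rational function of \<open>a\<close> and \<open>b\<close>.\<close>

lemma q_rat_deriv2_invert:
  assumes "a > 0" "b > 0" "coprime a b"
  shows "q_rat_deriv2 a b = 2 * (q_rat_deriv1 b a)\<^sup>2 / (of_int b / of_int a) ^ 3
    - (q_rat_deriv2 b a + 2 * q_rat_deriv1 b a) / (of_int b / of_int a)\<^sup>2"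
proof -
  define A B :: real where "A = of_int a" and "B = of_int b"
  define M where "M = apostol_sum b a"
  have pos: "A > 0" "B > 0" using assms by (simp_all add: A_def B_def)
  have rec: "apostol_sum a b = (- (A ^ 4 + B ^ 4 - 5 * A\<^sup>2 * B\<^sup>2 + 3) / 60 - B * A\<^sup>2 * M) / (A * B\<^sup>2)"
    using apostol_reciprocity[OF assms] pos
    unfolding A_def[symmetric] B_def[symmetric] M_def[symmetric] by (simp add: divide_simps) argo
  show ?thesis
    unfolding q_rat_deriv1_def q_rat_deriv2_def F_fun_def G_fun_def
      A_def[symmetric] B_def[symmetric] M_def[symmetric] rec
    using pos by (simp add: divide_simps) algebra
qed

text \<open>The tail of a continued fraction is a \<open>q\<close>-continued fraction in \<open>1 / q\<close>, so the induction
  needs a general parameter \<open>Q\<close> with value \<open>1\<close> at \<open>q = 1\<close>. If \<open>d\<close> and \<open>e\<close> are the first two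
  derivatives of \<open>Q\<close>, the claim is the chain rule for \<open>[x]\<^sub>Q\<close>. Passing to \<open>1 / Q\<close> turns \<open>(d, e)\<close> into
  \<open>(- d, 2 d\<^sup>2 - e)\<close>.\<close>

lemma jet_q_cf:
  assumes "as \<noteq> []" "\<forall>c \<in> set (tl as). c \<ge> 1" "cf_value as = of_int a / of_int b"
    and "b > 0" "coprime a b"
    and "jet Q 1 d e" "Q \<noteq> 0" "Q \<noteq> 1"
  shows "jet (q_cf Q as) (of_int a / of_int b) (d * q_rat_deriv1 a b)
    (d\<^sup>2 * q_rat_deriv2 a b + e * q_rat_deriv1 a b)"
  using assms
proof (induction as arbitrary: a b Q d e)
  case Nil
  thus ?case by simp
next
  case (Cons c as)
  note q = Cons.prems(6-8)
  have b: "b > 0" by fact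
  \<comment> \<open>\<open>s / b\<close> is what remains of \<open>a / b\<close> after subtracting the leading entry \<open>c\<close>\<close>
  define s where "s = a - c * b"
  have a: "a = s + c * b" by (simp add: s_def)
  have cop: "coprime b s"
    using Cons.prems(5) gcd_add_mult[of b c s]
    by (simp add: a coprime_iff_gcd_eq_1 gcd.commute add.commute)
  show ?case
  proof (cases "as = []")
    case True
    hence "rat_of_int a / of_int b = of_int c" using Cons.prems(3) by simp
    hence "rat_of_int a = of_int (c * b)" using b by (simp add: field_simps)
    hence "s = 0" by (simp only: of_int_eq_iff s_def)
    hence "b = 1" using cop b by simp
    have s0: "q_rat_deriv1 0 1 = 0" "q_rat_deriv2 0 1 = 0"
      by (simp_all add: q_rat_deriv1_def q_rat_deriv2_def F_fun_def G_fun_def apostol_sum_def cubic_def)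
    have derivs: "q_rat_deriv1 c 1 = of_int c * (of_int c - 1) / 2"
      "q_rat_deriv2 c 1 = of_int c * (of_int c - 1) * (of_int c - 2) / 3"
      using q_rat_deriv1_translate[of 1 0 c] q_rat_deriv2_translate[of 1 0 c] by (simp_all add: s0)
    have "jet (q_int Q c) (of_int c) (d * q_rat_deriv1 c 1)
        (d\<^sup>2 * q_rat_deriv2 c 1 + e * q_rat_deriv1 c 1)"
      unfolding derivs by (rule jet_eqI[OF jet_q_int[OF q]]) (simp_all add: mult_ac)
    thus ?thesis by (simp add: True a \<open>s = 0\<close> \<open>b = 1\<close>)
  next
    case False
    have ge: "\<forall>c \<in> set as. c \<ge> 1" using Cons.prems(2) by simp
    have v: "cf_value as \<ge> 1" using cf_value_ge_1[OF False ge] .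
    have "of_int c + 1 / cf_value as = of_int a / of_int b"
      using Cons.prems(3) cf_value_Cons[OF False, of c] by simp
    hence inv: "1 / cf_value as = of_int s / of_int b"
      using b by (simp add: a field_simps)
    have "rat_of_int s / of_int b > 0" using v unfolding inv[symmetric] by simp
    hence s: "s > 0" using b by (simp add: zero_less_divide_iff)
    have val: "cf_value as = of_int b / of_int s"
      using arg_cong[OF inv, of inverse] by (simp add: divide_inverse)
    have jinv: "jet (1 / Q) 1 (- d) (2 * d\<^sup>2 - e)"
      using jet_inverse[OF q(1)] by (simp add: inverse_eq_divide)
    define y z where "y = real_of_int b / of_int s" and "z = real_of_int s / of_int b"
    have "y \<noteq> 0" "1 / y = z" using s b by (simp_all add: y_def z_def)
    have IH: "jet (q_cf (1 / Q) as) y (- d * q_rat_deriv1 b s)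
        ((- d)\<^sup>2 * q_rat_deriv2 b s + (2 * d\<^sup>2 - e) * q_rat_deriv1 b s)"
      unfolding y_def
      using q ge False by (intro Cons.IH val s cop jinv) (auto dest: list.set_sel(2))
    have invert1: "q_rat_deriv1 s b = q_rat_deriv1 b s / y\<^sup>2"
      unfolding y_def by (rule q_rat_deriv1_invert[OF s b])
    have invert2: "q_rat_deriv2 s b = 2 * (q_rat_deriv1 b s)\<^sup>2 / y ^ 3
        - (q_rat_deriv2 b s + 2 * q_rat_deriv1 b s) / y\<^sup>2"
      unfolding y_def using cop by (intro q_rat_deriv2_invert[OF s b]) (simp add: coprime_commute)
    have jtail: "jet (inverse (q_cf (1 / Q) as)) z (d * q_rat_deriv1 s b)
        (d\<^sup>2 * q_rat_deriv2 s b + e * q_rat_deriv1 s b)"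
      unfolding invert1 invert2
      by (rule jet_eqI[OF jet_inverse[OF IH \<open>y \<noteq> 0\<close>]])
        (simp_all add: \<open>1 / y = z\<close> algebra_simps add_divide_distrib diff_divide_distrib power_mult_distrib)
    have translate: "of_int a / of_int b = of_int c + z"
      "q_rat_deriv1 a b = of_int c * (of_int c - 1) / 2 + of_int c * z + q_rat_deriv1 s b"
      "q_rat_deriv2 a b = of_int c * (of_int c - 1) * (of_int c - 2) / 3
        + of_int c * (of_int c - 1) * z + 2 * of_int c * q_rat_deriv1 s b + q_rat_deriv2 s b"
      using q_rat_deriv1_translate[OF b] q_rat_deriv2_translate[OF b] b unfolding a z_def
      by (simp_all add: add_divide_distrib)
    have "q_cf Q (c # as) = q_int Q c + Q powi c * inverse (q_cf (1 / Q) as)"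
      by (simp add: q_cf_Cons[OF False] divide_inverse)
    thus ?thesis
      unfolding translate
      by (simp only:, intro jet_eqI[OF jet_add[OF jet_q_int[OF q] jet_mult[OF jet_power_int[OF q(1,2)] jtail]]])
        (simp_all add: algebra_simps power2_eq_square)
  qed
qed

lemma thomae_fraction:
  fixes a b :: int
  assumes "b > 0" "coprime a b"
  shows "thomae (of_int a / of_int b) = 1 / of_int b"
proof -
  have "(THE b'. b' > 0 \<and> (\<exists>a'::int. coprime a' b' \<and> real_of_int a / of_int b = of_int a' / of_int b')) = b"
  proof (rule the_equality)
    show "b > 0 \<and> (\<exists>a'. coprime a' b \<and> real_of_int a / of_int b = of_int a' / of_int b)"
      using assms by blast
  next
    fix b' :: int
    assume "b' > 0 \<and> (\<exists>a'::int. coprime a' b' \<and> real_of_int a / of_int b = of_int a' / of_int b')"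
    then obtain a' where *: "b' > 0" "coprime a' b'" "real_of_int a / of_int b = of_int a' / of_int b'"
      by blast
    hence "real_of_int (a * b') = of_int (a' * b)" using assms(1) by (simp add: field_simps)
    hence eq: "a * b' = a' * b" by (simp only: of_int_eq_iff)
    have "b dvd b'" using eq assms(2) by (metis coprime_commute coprime_dvd_mult_right_iff dvd_triv_right)
    moreover have "b' dvd b" using eq *(2) by (metis coprime_commute coprime_dvd_mult_right_iff dvd_triv_right)
    ultimately show "b' = b" using assms(1) *(1) by (simp add: zdvd_antisym_nonneg)
  qed
  thus ?thesis by (simp add: thomae_def)
qed

theorem theorem1p2:
  fixes a b :: int
  assumes "b > 0" and "coprime a b"
  shows "(deriv ^^ 2) (ratfun_eval (q_rat (of_int a / of_int b))) 1 =
    F_fun (of_int a / of_int b)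
    + (thomae (of_int a / of_int b))\<^sup>2 * G_fun (of_int a / of_int b)
    + 20 * (\<Sum>n = 1..b - 1. bracket n a b * H_fun (of_int n / of_int b))"
proof -
  obtain as where as: "is_cf_expansion as (of_int a / of_int b)"
    using cf_expansion_exists by blast
  have "ratfun_var \<noteq> 0" "ratfun_var \<noteq> 1"
    by (simp_all add: ratfun_var_def Zero_fract_def One_fract_def eq_fract one_pCons
        del: pCons_one)
  hence "jet (q_rat (of_int a / of_int b)) (of_int a / of_int b) (1 * q_rat_deriv1 a b)
      (1\<^sup>2 * q_rat_deriv2 a b + 0 * q_rat_deriv1 a b)"
    unfolding q_rat_eq[OF as] using as assms
    by (intro jet_q_cf jet_ratfun_var) (auto simp: is_cf_expansion_def)
  hence "(deriv ^^ 2) (ratfun_eval (q_rat (of_int a / of_int b))) 1 = q_rat_deriv2 a b"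
    using deriv2_ratfun_eval by fastforce
  also have "\<dots> = F_fun (of_int a / of_int b)
    + (thomae (of_int a / of_int b))\<^sup>2 * G_fun (of_int a / of_int b)
    + 20 * (\<Sum>n = 1..b - 1. bracket n a b * H_fun (of_int n / of_int b))"
    using sum_bracket_H[OF assms] thomae_fraction[OF assms]
    by (simp add: q_rat_deriv2_def power_divide)
  finally show ?thesis .
qed

end
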